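(* Let $\mathcal{A},\mathcal{X},\mathcal{L}$ be sets and let $\Phi:\mathcal{A}\times\mathcal{X}\to\mathcal{L}$ be a lunar map. Then the Hankel system $\{\Gamma_\ell^\Phi\}_{\ell\in\mathcal{L}}\subset B(\ell^2(\mathcal{X}),\ell^2(\mathcal{A}))$ has hereditary SAP; that is, for any subsets $S_1\subset\mathcal{A}$ and $S_2\subset\mathcal{X}$, the compressed system $\{P_{S_1}\Gamma_\ell^\Phi P_{S_2}\}_{\ell\in\mathcal{L}}$ has the self-absorption property (SAP).
   Context: Lunar map: $\Phi:\mathcal{A}\times\mathcal{X}\to\mathcal{L}$ is lunar if (i) it is coordinatewise injective, i.e. $\Phi(a,\cdot)$ is injective on $\mathcal{X}$ for each $a\in\mathcal{A}$ and $\Phi(\cdot,x)$ is injective on $\mathcal{A}$ for each $x\in\mathcal{X}$; and (ii) for all $a,b,c,d\in\mathcal{A}$ and $x,y,z,w\in\mathcal{X}$, $$\big(\Phi(a,x)=\Phi(b,y),\ \Phi(c,x)=\Phi(d,y),\ \Phi(a,z)=\Phi(b,w)\big)\Longrightarrow \Phi(c,z)=\Phi(d,w).$$ Hankel system of $\Phi$: $\Gamma_\ell^\Phi\in B(\ell^2(\mathcal{X}),\ell^2(\mathcal{A}))$ is the operator with matrix $\Gamma_\ell^\Phi(a,x)=1$ if $\Phi(a,x)=\ell$ and $0$ otherwise. $P_{S_1}$ and $P_{S_2}$ denote the orthogonal projections of $\ell^2(\mathcal{A})$ onto $\ell^2(S_1)$ and of $\ell^2(\mathcal{X})$ onto $\ell^2(S_2)$.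 SAP: a family $\{x_i\}_{i\in I}$ in an operator space $A$ (for instance $A=B(\ell^2(\mathcal{X}),\ell^2(\mathcal{A}))$ or a $C^*$-algebra) has the self-absorption property (SAP) if for every $C^*$-algebra $B$ and every finitely supported family $(b_i)_{i\in I}$ in $B$, $$\Big\|\sum_{i} b_i\otimes x_i\Big\|_{B\otimes_{\min}A}=\Big\|\sum_{i} b_i\otimes x_i\otimes\overline{x}_i\Big\|_{B\otimes_{\min}A\otimes_{\min}\overline{A}} .$$ Here $\otimes_{\min}$ is the minimal tensor product and $\overline{A}$ is the complex conjugate of $A$, with $\overline{x}$ being $x$ viewed in $\overline{A}$; for operators between $\ell^2$-spaces, $\overline{x}$ is identified with the entrywise complex conjugate matrix of $x$. *)

theory Defs
  imports "HOL-Analysis.Analysis"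
begin

section \<open>Complex vector spaces and abstract C*-algebras\<close>

class scaleC = scaleR +
  fixes scaleC :: "complex \<Rightarrow> 'a \<Rightarrow> 'a" (infixr \<open>*\<^sub>C\<close> 75)
  assumes scaleR_scaleC: "scaleR r x = scaleC (complex_of_real r) x"

class complex_vector = scaleC + ab_group_add +
  assumes scaleC_add_right: "a *\<^sub>C (x + y) = a *\<^sub>C x + a *\<^sub>C y"
    and scaleC_add_left: "(a + b) *\<^sub>C x = a *\<^sub>C x + b *\<^sub>C x"
    and scaleC_scaleC: "a *\<^sub>C (b *\<^sub>C x) = (a * b) *\<^sub>C x"
    and scaleC_one: "1 *\<^sub>C x = x"

text \<open>Neither a unit nor nontriviality is required.\<close>

class cstar_algebra = complex_vector + real_normed_algebra + banach +
  fixes star :: "'a \<Rightarrow> 'a"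
  assumes scaleC_mult_left: "(a *\<^sub>C x) * y = a *\<^sub>C (x * y)"
    and scaleC_mult_right: "x * (a *\<^sub>C y) = a *\<^sub>C (x * y)"
    and norm_scaleC: "norm (a *\<^sub>C x) = cmod a * norm x"
    and star_star: "star (star x) = x"
    and star_add: "star (x + y) = star x + star y"
    and star_scaleC: "star (a *\<^sub>C x) = cnj a *\<^sub>C star x"
    and star_mult: "star (x * y) = star y * star x"
    and cstar_identity: "norm (star x * x) = (norm x)\<^sup>2"

instantiation complex :: cstar_algebra
begin
definition scaleC_complex :: "complex \<Rightarrow> complex \<Rightarrow> complex"
  where "scaleC_complex a x = a * x"
definition star_complex :: "complex \<Rightarrow> complex"
  where "star_complex = cnj"
instance
  by standard
    (auto simp: scaleC_complex_def star_complex_def scaleR_conv_of_real algebra_simps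
      norm_mult power2_eq_square)
end

section \<open>The Hilbert spaces \<open>\<ell>\<^sup>2\<close>\<close>

typedef 'a ell2 = "{f :: 'a \<Rightarrow> complex. (\<lambda>x. (cmod (f x))\<^sup>2) summable_on UNIV}"
  morphisms coord Abs_ell2
  by (rule exI[of _ "\<lambda>_. 0"]) simp

setup_lifting type_definition_ell2

lemma ell2_product_abs_summable:
  fixes f g :: "'a \<Rightarrow> complex"
  assumes "(\<lambda>x. (cmod (f x))\<^sup>2) summable_on UNIV" "(\<lambda>x. (cmod (g x))\<^sup>2) summable_on UNIV"
  shows "(\<lambda>x. cmod (cnj (f x) * g x)) summable_on UNIV"
proof (rule summable_on_comparison_test)
  show "(\<lambda>x. (cmod (f x))\<^sup>2 + (cmod (g x))\<^sup>2) summable_on UNIV"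
    using assms by (rule summable_on_add)
  fix x
  have "2 * (cmod (f x) * cmod (g x)) \<le> (cmod (f x))\<^sup>2 + (cmod (g x))\<^sup>2"
    using sum_squares_bound[of "cmod (f x)" "cmod (g x)"] by simp
  moreover have "0 \<le> cmod (f x) * cmod (g x)" by simp
  ultimately show "cmod (cnj (f x) * g x) \<le> (cmod (f x))\<^sup>2 + (cmod (g x))\<^sup>2"
    unfolding norm_mult complex_mod_cnj by linarith
qed simp

lemma ell2_add_closed:
  fixes f g :: "'a \<Rightarrow> complex"
  assumes "(\<lambda>x. (cmod (f x))\<^sup>2) summable_on UNIV" "(\<lambda>x. (cmod (g x))\<^sup>2) summable_on UNIV"
  shows "(\<lambda>x. (cmod (f x + g x))\<^sup>2) summable_on UNIV"
proof (rule summable_on_comparison_test)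
  show "(\<lambda>x. 2 * (cmod (f x))\<^sup>2 + 2 * (cmod (g x))\<^sup>2) summable_on UNIV"
    using assms by (intro summable_on_add summable_on_cmult_right)
  fix x
  have "(cmod (f x + g x))\<^sup>2 \<le> (cmod (f x) + cmod (g x))\<^sup>2"
    by (intro power_mono norm_triangle_ineq) simp
  also have "\<dots> \<le> 2 * (cmod (f x))\<^sup>2 + 2 * (cmod (g x))\<^sup>2"
    using sum_squares_bound[of "cmod (f x)" "cmod (g x)"] by (simp add: power2_sum)
  finally show "(cmod (f x + g x))\<^sup>2 \<le> 2 * (cmod (f x))\<^sup>2 + 2 * (cmod (g x))\<^sup>2" .
qed simp

lemma ell2_mult_closed:
  fixes f :: "'a \<Rightarrow> complex"
  assumes "(\<lambda>x. (cmod (f x))\<^sup>2) summable_on UNIV"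
  shows "(\<lambda>x. (cmod (c * f x))\<^sup>2) summable_on UNIV"
  using summable_on_cmult_right[OF assms, of "(cmod c)\<^sup>2"]
  by (simp add: norm_mult power_mult_distrib)

instantiation ell2 :: (type) complex_vector
begin
lift_definition zero_ell2 :: "'a ell2" is "\<lambda>_. 0" by simp
lift_definition plus_ell2 :: "'a ell2 \<Rightarrow> 'a ell2 \<Rightarrow> 'a ell2" is "\<lambda>f g x. f x + g x"
  by (rule ell2_add_closed)
lift_definition uminus_ell2 :: "'a ell2 \<Rightarrow> 'a ell2" is "\<lambda>f x. - f x" by simp
lift_definition minus_ell2 :: "'a ell2 \<Rightarrow> 'a ell2 \<Rightarrow> 'a ell2" is "\<lambda>f g x. f x - g x"
proof -
  fix f g :: "'a \<Rightarrow> complex"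
  assume "(\<lambda>x. (cmod (f x))\<^sup>2) summable_on UNIV" "(\<lambda>x. (cmod (g x))\<^sup>2) summable_on UNIV"
  then show "(\<lambda>x. (cmod (f x - g x))\<^sup>2) summable_on UNIV"
    using ell2_add_closed[of f "\<lambda>x. - g x"] by simp
qed
lift_definition scaleC_ell2 :: "complex \<Rightarrow> 'a ell2 \<Rightarrow> 'a ell2" is "\<lambda>c f x. c * f x"
  by (rule ell2_mult_closed)
lift_definition scaleR_ell2 :: "real \<Rightarrow> 'a ell2 \<Rightarrow> 'a ell2" is "\<lambda>r f x. complex_of_real r * f x"
  by (rule ell2_mult_closed)
instance
  by standard (transfer; simp add: algebra_simps fun_eq_iff)+
end

definition cinner :: "'a ell2 \<Rightarrow> 'a ell2 \<Rightarrow> complex"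
  where "cinner f g = (\<Sum>\<^sub>\<infinity>x. cnj (coord f x) * coord g x)"

lemma cinner_summable: "(\<lambda>x. cnj (coord f x) * coord g x) summable_on UNIV"
  using coord[of f] coord[of g]
  by (intro abs_summable_summable[OF ell2_product_abs_summable]) auto

lemma cinner_self: "cinner f f = complex_of_real (\<Sum>\<^sub>\<infinity>x. (cmod (coord f x))\<^sup>2)"
proof -
  have "cinner f f = (\<Sum>\<^sub>\<infinity>x. complex_of_real ((cmod (coord f x))\<^sup>2))"
    unfolding cinner_def complex_norm_square by (simp only: mult.commute)
  also have "\<dots> = complex_of_real (\<Sum>\<^sub>\<infinity>x. (cmod (coord f x))\<^sup>2)"
    using coord[of f] by (intro infsumI[OF has_sum_of_real[OF has_sum_infsum]]) simp
  finally show ?thesis .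
qed

lemma cinner_add_left: "cinner (f + g) h = cinner f h + cinner g h"
  using infsum_add[OF cinner_summable[of f h] cinner_summable[of g h]]
  by (simp add: cinner_def plus_ell2.rep_eq algebra_simps)

lemma cinner_scaleR_left: "cinner (r *\<^sub>R f) g = complex_of_real r * cinner f g"
  by (simp add: cinner_def scaleR_ell2.rep_eq mult.assoc infsum_cmult_right')

lemma cinner_commute: "cinner g f = cnj (cinner f g)"
  unfolding cinner_def infsum_cnj[symmetric] by (simp add: mult.commute)

text \<open>The real inner product \<open>Re \<langle>f, g\<rangle>\<close> makes the library's norm, \<open>bounded_linear\<close> and
  \<open>onorm\<close> available; it induces the norm of the complex Hilbert space.\<close>

instantiation ell2 :: (type) real_inner
begin
definition inner_ell2 :: "'a ell2 \<Rightarrow> 'a ell2 \<Rightarrow> real"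
  where "inner_ell2 f g = Re (cinner f g)"
definition norm_ell2 :: "'a ell2 \<Rightarrow> real"
  where "norm_ell2 f = sqrt (\<Sum>\<^sub>\<infinity>x. (cmod (coord f x))\<^sup>2)"
definition dist_ell2 :: "'a ell2 \<Rightarrow> 'a ell2 \<Rightarrow> real"
  where "dist_ell2 f g = norm (f - g)"
definition sgn_ell2 :: "'a ell2 \<Rightarrow> 'a ell2"
  where "sgn_ell2 f = f /\<^sub>R norm f"
definition uniformity_ell2 :: "('a ell2 \<times> 'a ell2) filter"
  where "uniformity_ell2 = (INF e\<in>{0<..}. principal {(f, g). dist f g < e})"
definition open_ell2 :: "'a ell2 set \<Rightarrow> bool"
  where "open_ell2 U = (\<forall>f\<in>U. \<forall>\<^sub>F (f', g) in uniformity. f' = f \<longrightarrow> g \<in> U)"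
instance
proof
  fix f g h :: "'a ell2" and r s :: real
  show "r *\<^sub>R (f + g) = r *\<^sub>R f + r *\<^sub>R g" "(r + s) *\<^sub>R f = r *\<^sub>R f + s *\<^sub>R f"
    "r *\<^sub>R s *\<^sub>R f = (r * s) *\<^sub>R f" "1 *\<^sub>R f = f"
    by (transfer; simp add: algebra_simps)+
  show "inner f g = inner g f"
    unfolding inner_ell2_def by (subst cinner_commute) simp
  show "inner (f + g) h = inner f h + inner g h"
    by (simp add: inner_ell2_def cinner_add_left)
  show "inner (r *\<^sub>R f) g = r * inner f g"
    by (simp add: inner_ell2_def cinner_scaleR_left)
  show "0 \<le> inner f f"
    by (simp add: inner_ell2_def cinner_self infsum_nonneg)
  show "norm f = sqrt (inner f f)"
    by (simp add: norm_ell2_def inner_ell2_def cinner_self)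
  show "inner f f = 0 \<longleftrightarrow> f = 0"
  proof
    assume "inner f f = 0"
    then have *: "(\<Sum>\<^sub>\<infinity>x. (cmod (coord f x))\<^sup>2) = 0"
      by (simp add: inner_ell2_def cinner_self)
    have "(cmod (coord f x))\<^sup>2 = 0" for x
      using * coord[of f] by (intro nonneg_infsum_le_0D[of _ UNIV]) auto
    then show "f = 0"
      by (simp add: coord_inject[symmetric] zero_ell2.rep_eq fun_eq_iff)
  next
    assume "f = 0"
    then show "inner f f = 0"
      by (simp add: inner_ell2_def cinner_def zero_ell2.rep_eq)
  qed
qed (simp_all only: dist_ell2_def sgn_ell2_def uniformity_ell2_def open_ell2_def)
end

section \<open>Bounded operators between \<open>\<ell>\<^sup>2\<close>-spaces\<close>

definition bounded_clinear :: "('x ell2 \<Rightarrow> 'a ell2) \<Rightarrow> bool"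
  where "bounded_clinear T \<longleftrightarrow> bounded_linear T \<and> (\<forall>c f. T (c *\<^sub>C f) = c *\<^sub>C T f)"

lift_definition delta :: "'x \<Rightarrow> 'x ell2" is "\<lambda>x y. if y = x then 1 else 0"
proof -
  fix x :: 'x
  show "(\<lambda>y. (cmod (if y = x then 1 else 0))\<^sup>2) summable_on UNIV"
    by (rule finite_nonzero_values_imp_summable_on) simp
qed

definition entry :: "('x ell2 \<Rightarrow> 'a ell2) \<Rightarrow> 'a \<Rightarrow> 'x \<Rightarrow> complex"
  where "entry T a x = coord (T (delta x)) a"

text \<open>A bounded operator is determined by its matrix; the description below is meaningful
  only for matrices of bounded operators.\<close>

definition op_of_matrix :: "('a \<Rightarrow> 'x \<Rightarrow> complex) \<Rightarrow> 'x ell2 \<Rightarrow> 'a ell2"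
  where "op_of_matrix M = (THE T. bounded_clinear T \<and> (\<forall>a x. entry T a x = M a x))"

definition conj_op :: "('x ell2 \<Rightarrow> 'a ell2) \<Rightarrow> 'x ell2 \<Rightarrow> 'a ell2"
  where "conj_op T = op_of_matrix (\<lambda>a x. cnj (entry T a x))"

lift_definition proj :: "'x set \<Rightarrow> 'x ell2 \<Rightarrow> 'x ell2" is "\<lambda>S f x. if x \<in> S then f x else 0"
proof -
  fix S :: "'x set" and f :: "'x \<Rightarrow> complex"
  assume "(\<lambda>x. (cmod (f x))\<^sup>2) summable_on UNIV"
  then show "(\<lambda>x. (cmod (if x \<in> S then f x else 0))\<^sup>2) summable_on UNIV"
    by (rule summable_on_comparison_test) auto
qed

text \<open>The Hilbert space tensor product of \<open>\<ell>\<^sup>2(X)\<close> and \<open>\<ell>\<^sup>2(Y)\<close> is realised as \<open>\<ell>\<^sup>2(X \<times> Y)\<close>.\<close>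

lift_definition tensor_vec :: "'x ell2 \<Rightarrow> 'y ell2 \<Rightarrow> ('x \<times> 'y) ell2" is "\<lambda>f g (x, y). f x * g y"
proof -
  fix f :: "'x \<Rightarrow> complex" and g :: "'y \<Rightarrow> complex"
  assume f: "(\<lambda>x. (cmod (f x))\<^sup>2) summable_on UNIV"
    and g: "(\<lambda>y. (cmod (g y))\<^sup>2) summable_on UNIV"
  have "(\<lambda>(x, y). (cmod (f x))\<^sup>2 * (cmod (g y))\<^sup>2) summable_on UNIV \<times> UNIV"
  proof (rule summable_on_SigmaI)
    fix x
    show "((\<lambda>y. case (x, y) of (x, y) \<Rightarrow> (cmod (f x))\<^sup>2 * (cmod (g y))\<^sup>2) has_sum
        (cmod (f x))\<^sup>2 * (\<Sum>\<^sub>\<infinity>y. (cmod (g y))\<^sup>2)) UNIV"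
      unfolding prod.case by (rule has_sum_cmult_right[OF has_sum_infsum[OF g]])
    show "(\<lambda>x. (cmod (f x))\<^sup>2 * (\<Sum>\<^sub>\<infinity>y. (cmod (g y))\<^sup>2)) summable_on UNIV"
      using f by (rule summable_on_cmult_left)
  qed (simp only: prod.case mult_nonneg_nonneg zero_le_power2)
  then show "(\<lambda>p. (cmod (case p of (x, y) \<Rightarrow> f x * g y))\<^sup>2) summable_on UNIV"
    by (simp add: norm_mult power_mult_distrib case_prod_unfold)
qed

definition tensor_op ::
    "('x ell2 \<Rightarrow> 'a ell2) \<Rightarrow> ('y ell2 \<Rightarrow> 'b ell2) \<Rightarrow> ('x \<times> 'y) ell2 \<Rightarrow> ('a \<times> 'b) ell2"
  where "tensor_op T S =
    (THE U. bounded_clinear U \<and> (\<forall>f g. U (tensor_vec f g) = tensor_vec (T f) (S g)))"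

section \<open>The minimal tensor norm and the self-absorption property\<close>

definition star_representation :: "('b::cstar_algebra \<Rightarrow> 'h ell2 \<Rightarrow> 'h ell2) \<Rightarrow> bool"
  where "star_representation \<pi> \<longleftrightarrow>
    (\<forall>b. bounded_clinear (\<pi> b)) \<and>
    (\<forall>b c f. \<pi> (b + c) f = \<pi> b f + \<pi> c f) \<and>
    (\<forall>z b f. \<pi> (z *\<^sub>C b) f = z *\<^sub>C \<pi> b f) \<and>
    (\<forall>b c f. \<pi> (b * c) f = \<pi> b (\<pi> c f)) \<and>
    (\<forall>b f g. cinner (\<pi> (star b) f) g = cinner f (\<pi> b g))"

text \<open>The norm of \<open>\<Sum>\<^sub>i b\<^sub>i \<otimes> x\<^sub>i\<close> in \<open>B \<otimes>\<^sub>m\<^sub>i\<^sub>n B(\<ell>\<^sup>2(X), \<ell>\<^sup>2(A))\<close>: the supremum of the operator norms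
  of \<open>\<Sum>\<^sub>i \<pi>(b\<^sub>i) \<otimes> x\<^sub>i\<close> over the representations \<open>\<pi>\<close> of \<open>B\<close>. All representations on \<open>\<ell>\<^sup>2(B)\<close> suffice:
  they need not be nondegenerate, and the space of a cyclic representation (in particular of the
  GNS representation of a state) has Hilbert dimension at most the cardinality of \<open>B\<close>, so that it
  embeds into \<open>\<ell>\<^sup>2(B)\<close>; the direct sum of the GNS representations is faithful.\<close>

definition min_norm ::
    "('i \<Rightarrow> 'b::cstar_algebra) \<Rightarrow> ('i \<Rightarrow> 'x ell2 \<Rightarrow> 'a ell2) \<Rightarrow> real"
  where "min_norm b x =
    (SUP \<pi>\<in>{\<pi> :: 'b \<Rightarrow> 'b ell2 \<Rightarrow> 'b ell2. star_representation \<pi>}.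
      onorm (\<lambda>\<xi>. \<Sum>i | b i \<noteq> 0. tensor_op (\<pi> (b i)) (x i) \<xi>))"

text \<open>The type argument is the coefficient algebra \<open>B\<close>: quantification over all C*-algebras is
  quantification over this type, which HOL permits only at the level of theorems. The triple
  tensor product is bracketed as \<open>B \<otimes> (A \<otimes> conj A)\<close>, with \<open>x\<^sub>i \<otimes> conj x\<^sub>i\<close> acting
  between \<open>\<ell>\<^sup>2\<close>-spaces.\<close>

definition has_sap :: "'b::cstar_algebra itself \<Rightarrow> ('i \<Rightarrow> 'x ell2 \<Rightarrow> 'a ell2) \<Rightarrow> bool"
  where "has_sap _ x \<longleftrightarrow>
    (\<forall>i. bounded_clinear (x i)) \<and>
    (\<forall>b :: 'i \<Rightarrow> 'b. finite {i. b i \<noteq> 0} \<longrightarrow>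
      min_norm b x = min_norm b (\<lambda>i. tensor_op (x i) (conj_op (x i))))"

definition has_hereditary_sap :: "'b::cstar_algebra itself \<Rightarrow> ('i \<Rightarrow> 'x ell2 \<Rightarrow> 'a ell2) \<Rightarrow> bool"
  where "has_hereditary_sap B x \<longleftrightarrow>
    (\<forall>S\<^sub>1 S\<^sub>2. has_sap B (\<lambda>i. proj S\<^sub>1 \<circ> x i \<circ> proj S\<^sub>2))"

section \<open>Lunar maps and Hankel systems\<close>

definition lunar :: "('a \<Rightarrow> 'x \<Rightarrow> 'l) \<Rightarrow> bool"
  where "lunar \<Phi> \<longleftrightarrow>
    (\<forall>a. inj (\<Phi> a)) \<and> (\<forall>x. inj (\<lambda>a. \<Phi> a x)) \<and>
    (\<forall>a b c d x y z w.
      \<Phi> a x = \<Phi> b y \<and> \<Phi> c x = \<Phi> d y \<and> \<Phi> a z = \<Phi> b w \<longrightarrow> \<Phi> c z = \<Phi> d w)"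

definition hankel :: "('a \<Rightarrow> 'x \<Rightarrow> 'l) \<Rightarrow> 'l \<Rightarrow> 'x ell2 \<Rightarrow> 'a ell2"
  where "hankel \<Phi> l = op_of_matrix (\<lambda>a x. if \<Phi> a x = l then 1 else 0)"

end

theory Submission
  imports Defs
begin

text \<open>The lunar condition says that a certain bipartite graph falls apart into complete bipartite
  pieces, and this makes the two norms in the self-absorption property agree one representation at a
  time, so that the suprema over all representations agree as well.

  Let \<open>R\<^sub>l\<close> be the relation \<open>\<Phi> a x = l\<close>, restricted to \<open>a \<in> S\<^sub>1\<close> and \<open>x \<in> S\<^sub>2\<close>. Coordinatewise
  injectivity makes each \<open>R\<^sub>l\<close> a partial bijection, and the compressed Hankel operator \<open>x\<^sub>l\<close> is the
  partial isometry with matrix \<open>R\<^sub>l\<close>. Its matrix is real, so \<open>x\<^sub>l \<otimes> conj x\<^sub>l\<close> is the partial isometry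
  of \<open>R\<^sub>l \<times> R\<^sub>l\<close>. Fix a representation and write \<open>T\<^sub>l\<close> for the images of the coefficients. The
  operators to compare are \<open>W = \<Sum>\<^sub>l T\<^sub>l \<otimes> R\<^sub>l\<close> and \<open>Z = \<Sum>\<^sub>l T\<^sub>l \<otimes> (R\<^sub>l \<times> R\<^sub>l)\<close>.

  The bound \<open>\<parallel>W\<parallel> \<le> \<parallel>Z\<parallel>\<close> comes from the diagonals of \<open>A \<times> A\<close> and \<open>X \<times> X\<close>, between which \<open>Z\<close> is a copy
  of \<open>W\<close> (lemma \<open>onorm_op_sum_le_square\<close>).

  For \<open>\<parallel>Z\<parallel> \<le> \<parallel>W\<parallel>\<close>, link \<open>(a, a')\<close> with \<open>(x, x')\<close> when some \<open>R\<^sub>l\<close> contains both \<open>(a, x)\<close> and \<open>(a', x')\<close>,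
  that is, when \<open>Z\<close> has a nonzero block there. The lunar condition turns every path of length three in this
  graph into an edge, so each connected component is a complete bipartite graph between some
  \<open>P \<subseteq> A \<times> A\<close> and \<open>Q \<subseteq> X \<times> X\<close>, and \<open>Z\<close> is the orthogonal sum of its parts over the components. By
  injectivity the first projection is injective on \<open>P\<close> and on \<open>Q\<close>; since all of \<open>P\<close> is linked to all of
  \<open>Q\<close>, it identifies the part of \<open>Z\<close> over the component with a submatrix of \<open>W\<close> (lemma \<open>block_bound\<close>).
  Summing the squared norms over the components gives the bound (lemma \<open>onorm_square_le_op_sum\<close>).

  The lunar condition on the restricted relations only concerns the points that remain, so it
  passes to all \<open>S\<^sub>1\<close> and \<open>S\<^sub>2\<close> (lemma \<open>lunar_family_compression\<close>); this is why the property is hereditary.\<close>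

section \<open>Vectors in \<open>\<ell>\<^sup>2\<close> and bounded operators\<close>

lemma ell2_eqI: "(\<And>x. coord f x = coord g x) \<Longrightarrow> f = g"
  by (simp add: coord_inject[symmetric] fun_eq_iff)

lemma coord_summable: "(\<lambda>x. (cmod (coord f x))\<^sup>2) summable_on UNIV"
  using coord[of f] by simp

lemma norm_ell2_sq: "(norm f)\<^sup>2 = (\<Sum>\<^sub>\<infinity>x. (cmod (coord f x))\<^sup>2)"
  by (simp add: norm_ell2_def infsum_nonneg)

lemma coord_sum: "coord (\<Sum>i\<in>A. f i) x = (\<Sum>i\<in>A. coord (f i) x)"
  by (induction A rule: infinite_finite_induct) (simp_all add: zero_ell2.rep_eq plus_ell2.rep_eq)

lemma scaleC_zero_right: "c *\<^sub>C (0 :: 'x ell2) = 0"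
  by (rule ell2_eqI) (simp add: scaleC_ell2.rep_eq zero_ell2.rep_eq)

lemma bounded_clinearI:
  assumes "\<And>f g. T (f + g) = T f + T g" "\<And>c f. T (c *\<^sub>C f) = c *\<^sub>C T f"
    "\<And>f. norm (T f) \<le> K * norm f"
  shows "bounded_clinear T"
  unfolding bounded_clinear_def
proof (intro conjI allI)
  show "bounded_linear T"
    by (rule bounded_linear_intro[where K = K])
      (simp_all add: assms scaleR_scaleC mult.commute)
qed (rule assms)

lemma bounded_clinear_bounded_linear: "bounded_clinear T \<Longrightarrow> bounded_linear T"
  and bounded_clinear_scaleC: "bounded_clinear T \<Longrightarrow> T (c *\<^sub>C f) = c *\<^sub>C T f"
  by (simp_all add: bounded_clinear_def)

lemma proj_insert:
  assumes "x \<notin> F"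
  shows "proj (insert x F) f = proj F f + coord f x *\<^sub>C delta x"
  using assms
  by (intro ell2_eqI) (auto simp: proj.rep_eq plus_ell2.rep_eq scaleC_ell2.rep_eq delta.rep_eq)

lemma norm_truncation_error:
  assumes "finite F"
  shows "(norm (f - proj F f))\<^sup>2 = (norm f)\<^sup>2 - (\<Sum>x\<in>F. (cmod (coord f x))\<^sup>2)"
proof -
  let ?g = "\<lambda>x. (cmod (coord f x))\<^sup>2"
  have "(norm (f - proj F f))\<^sup>2 = infsum ?g (UNIV - F)"
    unfolding norm_ell2_sq
    by (rule infsum_cong_neutral) (auto simp: minus_ell2.rep_eq proj.rep_eq)
  moreover have "infsum ?g UNIV = infsum ?g (UNIV - F) + infsum ?g F"
    using infsum_Un_disjoint[of ?g "UNIV - F" F] assms Diff_disjoint[of F UNIV]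
      summable_on_subset_banach[OF coord_summable, of "UNIV - F" f] by (simp add: Int_commute)
  ultimately show ?thesis
    using assms by (simp add: norm_ell2_sq)
qed

text \<open>The finite truncations of a vector converge to it, so that a bounded operator that kills
  all the basis vectors vanishes. This is what makes the definite descriptions
  behind matrices and tensor products of operators well defined.\<close>

lemma bounded_clinear_ext:
  fixes T S :: "'x ell2 \<Rightarrow> 'a ell2"
  assumes T: "bounded_clinear T" and S: "bounded_clinear S"
    and eq: "\<And>x. T (delta x) = S (delta x)"
  shows "T = S"
proof
  fix f :: "'x ell2"
  define D where "D = (\<lambda>f. T f - S f)"
  have D: "bounded_linear D"
    unfolding D_def using T S by (intro bounded_linear_sub bounded_clinear_bounded_linear)
  interpret D: bounded_linear D by (rule D)
  have D_delta: "D (c *\<^sub>C delta x) = 0" for c x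
    by (simp add: D_def bounded_clinear_scaleC[OF T] bounded_clinear_scaleC[OF S] eq)
  have proj_empty: "proj {} f = 0"
    by (rule ell2_eqI) (simp add: proj.rep_eq zero_ell2.rep_eq)
  have D_proj: "D (proj F f) = 0" if "finite F" for F
    using that
  proof induction
    case empty
    show ?case by (simp add: proj_empty D.zero)
  next
    case (insert x F)
    then show ?case by (simp add: proj_insert D.add D_delta)
  qed
  let ?e = "\<lambda>F. (onorm D)\<^sup>2 * ((norm f)\<^sup>2 - (\<Sum>x\<in>F. (cmod (coord f x))\<^sup>2))"
  have bound: "(norm (D f))\<^sup>2 \<le> ?e F" if "finite F" for F
  proof -
    have "norm (D f) = norm (D (f - proj F f))"
      using D_proj[OF that] by (simp add: D.diff)
    also have "\<dots> \<le> onorm D * norm (f - proj F f)"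
      by (rule onorm[OF D])
    finally have "(norm (D f))\<^sup>2 \<le> (onorm D * norm (f - proj F f))\<^sup>2"
      by (rule power_mono) simp
    then show ?thesis
      by (simp add: power_mult_distrib norm_truncation_error[OF that])
  qed
  have "(?e \<longlongrightarrow> (onorm D)\<^sup>2 * ((norm f)\<^sup>2 - (norm f)\<^sup>2)) (finite_subsets_at_top UNIV)"
    unfolding norm_ell2_sq by (intro tendsto_intros infsum_tendsto coord_summable)
  then have "(norm (D f))\<^sup>2 \<le> (onorm D)\<^sup>2 * ((norm f)\<^sup>2 - (norm f)\<^sup>2)"
    by (rule tendsto_lowerbound)
      (auto intro: eventually_finite_subsets_at_top_weakI bound)
  then show "T f = S f"
    by (simp add: D_def)
qed

lemma op_of_matrix_eqI:
  assumes "bounded_clinear T" "\<And>a x. entry T a x = M a x"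
  shows "op_of_matrix M = T"
  unfolding op_of_matrix_def
proof (rule the_equality)
  fix S
  assume "bounded_clinear S \<and> (\<forall>a x. entry S a x = M a x)"
  then show "S = T"
    using assms by (intro bounded_clinear_ext ell2_eqI) (auto simp: entry_def)
qed (use assms in simp)

lemma tensor_vec_delta: "tensor_vec (delta x) (delta y) = delta (x, y)"
  by (rule ell2_eqI) (auto simp: tensor_vec.rep_eq delta.rep_eq split: prod.splits)

lemma tensor_op_eqI:
  assumes "bounded_clinear U" "\<And>f g. U (tensor_vec f g) = tensor_vec (T f) (S g)"
  shows "tensor_op T S = U"
  unfolding tensor_op_def
proof (rule the_equality)
  fix V
  assume "bounded_clinear V \<and> (\<forall>f g. V (tensor_vec f g) = tensor_vec (T f) (S g))"
  then show "V = U"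
    using assms by (intro bounded_clinear_ext) (auto simp flip: tensor_vec_delta)
qed (use assms in simp)

section \<open>Slices of a vector in a tensor product\<close>

text \<open>A vector of \<open>\<ell>\<^sup>2(H \<times> X)\<close> is an \<open>X\<close>-indexed, square-summable family of vectors of \<open>\<ell>\<^sup>2(H)\<close>. In this
  picture tensoring the identity with a partial bijection only relabels members of the family, drops some
  of them and fills up with zeros.\<close>

lift_definition slice :: "('h \<times> 'x) ell2 \<Rightarrow> 'x \<Rightarrow> 'h ell2" is "\<lambda>\<xi> x h. \<xi> (h, x)"
proof -
  fix \<xi> :: "'h \<times> 'x \<Rightarrow> complex" and x
  assume "(\<lambda>p. (cmod (\<xi> p))\<^sup>2) summable_on UNIV"
  then have "(\<lambda>p. (cmod (\<xi> p))\<^sup>2) summable_on (\<lambda>h. (h, x)) ` UNIV"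
    by (rule summable_on_subset_banach) simp
  then show "(\<lambda>h. (cmod (\<xi> (h, x)))\<^sup>2) summable_on UNIV"
    by (subst (asm) summable_on_reindex) (auto simp: inj_on_def o_def)
qed

lemma slice_eqI: "(\<And>x. slice \<xi> x = slice \<eta> x) \<Longrightarrow> \<xi> = \<eta>"
  by (rule ell2_eqI) (metis slice.rep_eq surj_pair)

lemma slice_add: "slice (\<xi> + \<eta>) x = slice \<xi> x + slice \<eta> x"
  by (rule ell2_eqI) (simp add: slice.rep_eq plus_ell2.rep_eq)

lemma slice_scaleC: "slice (c *\<^sub>C \<xi>) x = c *\<^sub>C slice \<xi> x"
  by (rule ell2_eqI) (simp add: slice.rep_eq scaleC_ell2.rep_eq)

lemma slice_sum: "slice (\<Sum>i\<in>A. \<xi> i) x = (\<Sum>i\<in>A. slice (\<xi> i) x)"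
  by (rule ell2_eqI) (simp add: slice.rep_eq coord_sum)

lemma slice_tensor_vec: "slice (tensor_vec f g) x = coord g x *\<^sub>C f"
  by (rule ell2_eqI) (simp add: slice.rep_eq tensor_vec.rep_eq scaleC_ell2.rep_eq)

lemma norm_slices: "((\<lambda>x. (norm (slice \<xi> x))\<^sup>2) has_sum (norm \<xi>)\<^sup>2) UNIV"
proof -
  let ?g = "\<lambda>(x, h). (cmod (coord \<xi> (h, x)))\<^sup>2"
  have bij: "bij_betw prod.swap (UNIV \<times> UNIV) UNIV"
    by (simp add: bij_swap)
  have g: "?g = (\<lambda>p. (cmod (coord \<xi> (prod.swap p)))\<^sup>2)"
    by (auto simp: fun_eq_iff)
  have "?g summable_on UNIV \<times> UNIV"
    unfolding g using coord_summable[of \<xi>]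
    by (simp only: summable_on_reindex_bij_betw[OF bij, of "\<lambda>p. (cmod (coord \<xi> p))\<^sup>2"])
  moreover have "infsum ?g (UNIV \<times> UNIV) = (norm \<xi>)\<^sup>2"
    unfolding g norm_ell2_sq
    by (simp only: infsum_reindex_bij_betw[OF bij, of "\<lambda>p. (cmod (coord \<xi> p))\<^sup>2"])
  ultimately have sum: "(?g has_sum (norm \<xi>)\<^sup>2) (UNIV \<times> UNIV)"
    using has_sum_infsum by fastforce
  show ?thesis
  proof (rule has_sum_SigmaD[OF sum])
    fix x
    show "((\<lambda>h. ?g (x, h)) has_sum (norm (slice \<xi> x))\<^sup>2) UNIV"
      using has_sum_infsum[OF coord_summable[of "slice \<xi> x"]]
      by (simp add: norm_ell2_sq slice.rep_eq)
  qed
qed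

lemmas slices_summable = has_sum_imp_summable[OF norm_slices]

lemma norm_sq_slices: "(norm \<xi>)\<^sup>2 = (\<Sum>\<^sub>\<infinity>x. (norm (slice \<xi> x))\<^sup>2)"
  by (rule infsumI[OF norm_slices, symmetric])

definition join :: "('x \<Rightarrow> 'h ell2) \<Rightarrow> ('h \<times> 'x) ell2"
  where "join v = Abs_ell2 (\<lambda>(h, x). coord (v x) h)"

lemma slice_join:
  assumes "(\<lambda>x. (norm (v x))\<^sup>2) summable_on UNIV"
  shows "slice (join v) x = v x"
proof -
  let ?g = "\<lambda>(x, h). (cmod (coord (v x) h))\<^sup>2"
  have bij: "bij_betw prod.swap UNIV (UNIV \<times> UNIV)"
    by (simp add: bij_swap)
  have "?g summable_on UNIV \<times> UNIV"
  proof (rule summable_on_SigmaI)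
    fix x
    show "((\<lambda>h. ?g (x, h)) has_sum (norm (v x))\<^sup>2) UNIV"
      using has_sum_infsum[OF coord_summable[of "v x"]] by (simp add: norm_ell2_sq)
  qed (use assms in auto)
  then have "(\<lambda>p. ?g (prod.swap p)) summable_on UNIV"
    by (simp only: summable_on_reindex_bij_betw[OF bij, of ?g])
  then have "coord (join v) = (\<lambda>(h, x). coord (v x) h)"
    unfolding join_def by (intro Abs_ell2_inverse) (simp add: case_prod_unfold)
  then show ?thesis
    by (intro ell2_eqI) (simp add: slice.rep_eq)
qed

section \<open>Operators that move basis vectors along a partial bijection\<close>

text \<open>A relation \<open>R\<close> is read as a 0-1 matrix. The sets \<open>{x. R a x}\<close> have at most one element, so that
  \<open>\<Sum>x | R a x. v x\<close> stands for "\<open>v\<close> at the partner of \<open>a\<close>, or 0 if there is none" without a choice of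
  partner; it is visibly linear in \<open>v\<close> and well behaved under products of relations.\<close>

definition partial_bij :: "('a \<Rightarrow> 'x \<Rightarrow> bool) \<Rightarrow> bool"
  where "partial_bij R \<longleftrightarrow>
    (\<forall>a x y. R a x \<and> R a y \<longrightarrow> x = y) \<and> (\<forall>a b x. R a x \<and> R b x \<longrightarrow> a = b)"

lemma partial_bij_left: "partial_bij R \<Longrightarrow> R a x \<Longrightarrow> R a y \<Longrightarrow> x = y"
  and partial_bij_right: "partial_bij R \<Longrightarrow> R a x \<Longrightarrow> R b x \<Longrightarrow> a = b"
  unfolding partial_bij_def by blast+

lemma partial_bij_cases:
  assumes "partial_bij R"
  obtains "{x. R a x} = {}" | x where "R a x" "{x. R a x} = {x}"
  using assms by (auto simp: partial_bij_def)

lemma partial_bij_power2_norm_sum: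
  assumes "partial_bij R"
  shows "(norm (\<Sum>x | R a x. v x))\<^sup>2 = (\<Sum>x | R a x. (norm (v x))\<^sup>2)"
  by (rule partial_bij_cases[OF assms, of a]) simp_all

text \<open>Summing over the partners of all rows is a reindexing of the sum over the range of \<open>R\<close>; all the norm
  computations for operators built from \<open>R\<close> rest on this.\<close>

lemma partial_bij_has_sum:
  fixes g :: "'x \<Rightarrow> real"
  assumes R: "partial_bij R" and g: "g summable_on UNIV"
  shows "((\<lambda>a. \<Sum>x | R a x. g x) has_sum infsum g {x. \<exists>a. R a x}) UNIV"
proof -
  define D where "D = {a. \<exists>x. R a x}"
  define r where "r a = (THE x. R a x)" for a
  have r: "{x. R a x} = {r a}" if "a \<in> D" for a
    using that unfolding D_def r_def
    by (auto dest: partial_bij_left[OF R] intro: the_equality[symmetric])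
      (metis partial_bij_left[OF R] the_equality)
  have "(g has_sum infsum g {x. \<exists>a. R a x}) {x. \<exists>a. R a x}"
    using summable_on_subset_banach[OF g] by simp
  moreover have "{x. \<exists>a. R a x} = r ` D"
    using r by (fastforce simp: D_def)
  moreover have "inj_on r D"
    using r by (intro inj_onI) (metis partial_bij_right[OF R] mem_Collect_eq singletonI)
  ultimately have "((\<lambda>a. g (r a)) has_sum infsum g {x. \<exists>a. R a x}) D"
    by (simp add: has_sum_reindex o_def)
  moreover have "{x. R a x} = {}" if "a \<notin> D" for a
    using that by (auto simp: D_def)
  then have "((\<lambda>a. g (r a)) has_sum s) D \<longleftrightarrow> ((\<lambda>a. \<Sum>x | R a x. g x) has_sum s) UNIV" for s
    by (intro has_sum_cong_neutral) (auto simp: r)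
  ultimately show ?thesis
    by simp
qed

definition pbij_op :: "('a \<Rightarrow> 'x \<Rightarrow> bool) \<Rightarrow> 'x ell2 \<Rightarrow> 'a ell2"
  where "pbij_op R f = Abs_ell2 (\<lambda>a. \<Sum>x | R a x. coord f x)"

lemma coord_pbij_op:
  assumes "partial_bij R"
  shows "coord (pbij_op R f) a = (\<Sum>x | R a x. coord f x)"
  using has_sum_imp_summable[OF partial_bij_has_sum[OF assms coord_summable]]
  by (simp add: pbij_op_def Abs_ell2_inverse partial_bij_power2_norm_sum[OF assms])

lemma bounded_clinear_pbij_op:
  assumes "partial_bij R"
  shows "bounded_clinear (pbij_op R)"
proof (rule bounded_clinearI[where K = 1])
  fix f g :: "'b ell2" and c
  show "pbij_op R (f + g) = pbij_op R f + pbij_op R g"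
    by (rule ell2_eqI) (simp add: coord_pbij_op[OF assms] plus_ell2.rep_eq sum.distrib)
  show "pbij_op R (c *\<^sub>C f) = c *\<^sub>C pbij_op R f"
    by (rule ell2_eqI) (simp add: coord_pbij_op[OF assms] scaleC_ell2.rep_eq sum_distrib_left)
  have "(norm (pbij_op R f))\<^sup>2 = (\<Sum>\<^sub>\<infinity>x\<in>{x. \<exists>a. R a x}. (cmod (coord f x))\<^sup>2)"
    using infsumI[OF partial_bij_has_sum[OF assms coord_summable]]
    by (simp add: norm_ell2_sq coord_pbij_op[OF assms] partial_bij_power2_norm_sum[OF assms])
  also have "\<dots> \<le> (norm f)\<^sup>2"
    unfolding norm_ell2_sq
    by (intro infsum_mono2 coord_summable summable_on_subset_banach[OF coord_summable]) auto
  finally have "norm (pbij_op R f) \<le> norm f"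
    by (rule power2_le_imp_le) simp
  then show "norm (pbij_op R f) \<le> 1 * norm f"
    by simp
qed

lemma entry_pbij_op:
  assumes "partial_bij R"
  shows "entry (pbij_op R) a x = (if R a x then 1 else 0)"
  by (rule partial_bij_cases[OF assms, of a])
    (auto simp: entry_def coord_pbij_op[OF assms] delta.rep_eq)

lemma op_of_matrix_partial_bij:
  assumes "partial_bij R"
  shows "op_of_matrix (\<lambda>a x. if R a x then 1 else 0) = pbij_op R"
  by (intro op_of_matrix_eqI bounded_clinear_pbij_op entry_pbij_op assms)

lemma conj_op_pbij_op:
  assumes "partial_bij R"
  shows "conj_op (pbij_op R) = pbij_op R"
  unfolding conj_op_def
  by (intro op_of_matrix_eqI bounded_clinear_pbij_op)
    (simp_all add: assms entry_pbij_op)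

lemma proj_pbij_op:
  assumes "partial_bij R"
  shows "proj S\<^sub>1 \<circ> pbij_op R \<circ> proj S\<^sub>2 = pbij_op (\<lambda>a x. a \<in> S\<^sub>1 \<and> x \<in> S\<^sub>2 \<and> R a x)"
proof
  fix f
  have R': "partial_bij (\<lambda>a x. a \<in> S\<^sub>1 \<and> x \<in> S\<^sub>2 \<and> R a x)"
    using assms unfolding partial_bij_def by blast
  show "(proj S\<^sub>1 \<circ> pbij_op R \<circ> proj S\<^sub>2) f = pbij_op (\<lambda>a x. a \<in> S\<^sub>1 \<and> x \<in> S\<^sub>2 \<and> R a x) f"
  proof (rule ell2_eqI)
    fix a
    have R'_a: "{x. a \<in> S\<^sub>1 \<and> x \<in> S\<^sub>2 \<and> R a x} = (if a \<in> S\<^sub>1 then {x. R a x} \<inter> S\<^sub>2 else {})"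
      by auto
    show "coord ((proj S\<^sub>1 \<circ> pbij_op R \<circ> proj S\<^sub>2) f) a
      = coord (pbij_op (\<lambda>a x. a \<in> S\<^sub>1 \<and> x \<in> S\<^sub>2 \<and> R a x) f) a"
      by (rule partial_bij_cases[OF assms, of a])
        (simp_all add: R'_a proj.rep_eq coord_pbij_op[OF assms] coord_pbij_op[OF R'])
  qed
qed

section \<open>Tensoring a partial bijection with an operator\<close>

text \<open>This is \<open>T \<otimes> R\<close> described by slices. The description is only meaningful for bounded \<open>T\<close> and a partial
  bijection \<open>R\<close>, when the family of slices is square-summable.\<close>

definition amplify :: "('h ell2 \<Rightarrow> 'k ell2) \<Rightarrow> ('a \<Rightarrow> 'x \<Rightarrow> bool) \<Rightarrow> ('h \<times> 'x) ell2 \<Rightarrow> ('k \<times> 'a) ell2"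
  where "amplify T R \<xi> = join (\<lambda>a. \<Sum>x | R a x. T (slice \<xi> x))"

lemma amplified_slices_summable:
  assumes "bounded_clinear T"
  shows "(\<lambda>x. (norm (T (slice \<xi> x)))\<^sup>2) summable_on UNIV"
proof (rule summable_on_comparison_test)
  show "(\<lambda>x. (onorm T)\<^sup>2 * (norm (slice \<xi> x))\<^sup>2) summable_on UNIV"
    by (intro summable_on_cmult_right slices_summable)
  fix x
  have "norm (T (slice \<xi> x)) \<le> onorm T * norm (slice \<xi> x)"
    by (intro onorm bounded_clinear_bounded_linear assms)
  then show "(norm (T (slice \<xi> x)))\<^sup>2 \<le> (onorm T)\<^sup>2 * (norm (slice \<xi> x))\<^sup>2"
    unfolding power_mult_distrib[symmetric] by (rule power_mono) simp
qed simp

lemma slice_amplify: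
  assumes "bounded_clinear T" "partial_bij R"
  shows "slice (amplify T R \<xi>) a = (\<Sum>x | R a x. T (slice \<xi> x))"
  unfolding amplify_def using amplified_slices_summable[OF assms(1)]
  by (intro slice_join)
    (auto simp: partial_bij_power2_norm_sum[OF assms(2)]
      intro: has_sum_imp_summable[OF partial_bij_has_sum[OF assms(2)]])

lemma norm_amplify:
  assumes "bounded_clinear T" "partial_bij R"
  shows "(norm (amplify T R \<xi>))\<^sup>2 = (\<Sum>\<^sub>\<infinity>x\<in>{x. \<exists>a. R a x}. (norm (T (slice \<xi> x)))\<^sup>2)"
  using infsumI[OF partial_bij_has_sum[OF assms(2) amplified_slices_summable[OF assms(1)]]]
  by (simp add: norm_sq_slices slice_amplify[OF assms] partial_bij_power2_norm_sum[OF assms(2)])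

lemma bounded_clinear_amplify:
  assumes T: "bounded_clinear T" and R: "partial_bij R"
  shows "bounded_clinear (amplify T R)"
proof (rule bounded_clinearI[where K = "onorm T"])
  interpret T: bounded_linear T
    using T by (rule bounded_clinear_bounded_linear)
  fix \<xi> \<eta> :: "('a \<times> 'd) ell2" and c
  show "amplify T R (\<xi> + \<eta>) = amplify T R \<xi> + amplify T R \<eta>"
    by (rule slice_eqI) (simp add: slice_amplify[OF assms] slice_add T.add sum.distrib)
  show "amplify T R (c *\<^sub>C \<xi>) = c *\<^sub>C amplify T R \<xi>"
  proof (rule slice_eqI)
    fix a
    show "slice (amplify T R (c *\<^sub>C \<xi>)) a = slice (c *\<^sub>C amplify T R \<xi>) a"
      by (rule partial_bij_cases[OF R, of a])
        (simp_all add: slice_amplify[OF assms] slice_scaleC bounded_clinear_scaleC[OF T]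
          scaleC_zero_right)
  qed
  have pos: "0 \<le> onorm T"
    by (intro onorm_pos_le bounded_clinear_bounded_linear T)
  have "(norm (amplify T R \<xi>))\<^sup>2 \<le> (\<Sum>\<^sub>\<infinity>x. (onorm T)\<^sup>2 * (norm (slice \<xi> x))\<^sup>2)"
    unfolding norm_amplify[OF assms]
  proof (rule infsum_mono_neutral)
    fix x
    have "norm (T (slice \<xi> x)) \<le> onorm T * norm (slice \<xi> x)"
      by (intro onorm bounded_clinear_bounded_linear assms)
    then show "(norm (T (slice \<xi> x)))\<^sup>2 \<le> (onorm T)\<^sup>2 * (norm (slice \<xi> x))\<^sup>2"
      unfolding power_mult_distrib[symmetric] by (rule power_mono) simp
  qed (auto intro: summable_on_subset_banach[OF amplified_slices_summable[OF T]]
      summable_on_cmult_right slices_summable)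
  also have "\<dots> = (onorm T * norm \<xi>)\<^sup>2"
    by (simp add: infsum_cmult_right' norm_sq_slices[of \<xi>] power_mult_distrib)
  finally show "norm (amplify T R \<xi>) \<le> onorm T * norm \<xi>"
    by (rule power2_le_imp_le) (simp add: pos)
qed

lemma tensor_op_pbij_op:
  assumes T: "bounded_clinear T" and R: "partial_bij R"
  shows "tensor_op T (pbij_op R) = amplify T R"
proof (rule tensor_op_eqI[OF bounded_clinear_amplify[OF assms]])
  fix f g
  show "amplify T R (tensor_vec f g) = tensor_vec (T f) (pbij_op R g)"
  proof (rule slice_eqI)
    fix a
    show "slice (amplify T R (tensor_vec f g)) a = slice (tensor_vec (T f) (pbij_op R g)) a"
      by (rule partial_bij_cases[OF R, of a])
        (auto intro!: ell2_eqI simp: slice_amplify[OF assms] slice_tensor_vec coord_pbij_op[OF R]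
          bounded_clinear_scaleC[OF T] scaleC_ell2.rep_eq zero_ell2.rep_eq)
  qed
qed

lemma partial_bij_rel_prod:
  assumes "partial_bij R" "partial_bij S"
  shows "partial_bij (rel_prod R S)"
  using assms unfolding partial_bij_def rel_prod_sel prod_eq_iff by blast

text \<open>Viewed as an amplification, the operator on the left is computed by a double sum over partners, which is
  the sum over partners in the product relation.\<close>

lemma tensor_op_pbij_op_pbij_op:
  assumes R: "partial_bij R" and S: "partial_bij S"
  shows "tensor_op (pbij_op R) (pbij_op S) = pbij_op (rel_prod R S)"
proof
  fix \<xi>
  note RS = bounded_clinear_pbij_op[OF R] S
  show "tensor_op (pbij_op R) (pbij_op S) \<xi> = pbij_op (rel_prod R S) \<xi>"
    unfolding tensor_op_pbij_op[OF RS]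
  proof (intro slice_eqI ell2_eqI)
    fix a b
    have "coord (slice (amplify (pbij_op R) S \<xi>) b) a
      = (\<Sum>y | S b y. \<Sum>x | R a x. coord \<xi> (x, y))"
      by (simp add: slice_amplify[OF RS] coord_sum coord_pbij_op[OF R] slice.rep_eq)
    also have "\<dots> = (\<Sum>q\<in>{x. R a x} \<times> {y. S b y}. coord \<xi> q)"
      by (subst sum.swap) (simp add: sum.cartesian_product case_prod_unfold)
    also have "{x. R a x} \<times> {y. S b y} = {q. rel_prod R S (a, b) q}"
      by (auto simp: rel_prod_sel)
    finally show "coord (slice (amplify (pbij_op R) S \<xi>) b) a
      = coord (slice (pbij_op (rel_prod R S) \<xi>) b) a"
      by (simp add: slice.rep_eq coord_pbij_op[OF partial_bij_rel_prod[OF R S]])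
  qed
qed

lemma partial_bij_relcompp:
  assumes "partial_bij R" "partial_bij S"
  shows "partial_bij (R OO S)"
  using assms unfolding partial_bij_def relcompp_apply by metis

text \<open>The composition law \<open>(T \<otimes> R)(U \<otimes> S) = TU \<otimes> RS\<close>, in the form in which it is used: a slice depends only on
  the row of the composed relation at one point. To compare slices of two such operators it therefore suffices to
  compare rows of relations.\<close>

lemma slice_amplify_amplify:
  assumes T: "bounded_clinear T" and U: "bounded_clinear U"
    and R: "partial_bij R" and S: "partial_bij S"
  shows "slice (amplify T R (amplify U S \<xi>)) a = (\<Sum>x | (R OO S) a x. T (U (slice \<xi> x)))"
proof -
  interpret T: bounded_linear T
    using T by (rule bounded_clinear_bounded_linear)
  show ?thesis
  proof (rule partial_bij_cases[OF R, of a])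
    fix b
    assume "{x. R a x} = {b}"
    then have "{x. (R OO S) a x} = {x. S b x}" "{x. R a x} = {b}"
      by auto
    then show ?thesis
      by (simp add: slice_amplify[OF T R] slice_amplify[OF U S] T.sum)
  next
    assume "{x. R a x} = {}"
    moreover from this have "{x. (R OO S) a x} = {}"
      by auto
    ultimately show ?thesis
      by (simp add: slice_amplify[OF T R])
  qed
qed

lemma bounded_clinear_id: "bounded_clinear id"
  by (rule bounded_clinearI[where K = 1]) simp_all

text \<open>The operator \<open>1 \<otimes> R\<close>. It produces the test vectors that transport norm estimates between the two operators
  of the self-absorption property.\<close>

definition reindex :: "('a \<Rightarrow> 'x \<Rightarrow> bool) \<Rightarrow> ('h \<times> 'x) ell2 \<Rightarrow> ('h \<times> 'a) ell2"
  where "reindex = amplify id"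

lemma norm_reindex:
  assumes "partial_bij R"
  shows "(norm (reindex R \<xi>))\<^sup>2 = (\<Sum>\<^sub>\<infinity>x\<in>{x. \<exists>a. R a x}. (norm (slice \<xi> x))\<^sup>2)"
  unfolding reindex_def using norm_amplify[OF bounded_clinear_id assms] by simp

section \<open>Lunar families of partial bijections\<close>

text \<open>The edges of the bipartite graph between \<open>A \<times> A\<close> and \<open>X \<times> X\<close> that shows where
  \<open>\<Sum>\<^sub>l T\<^sub>l \<otimes> R\<^sub>l \<otimes> R\<^sub>l\<close> can have nonzero entries.\<close>

definition linked :: "('l \<Rightarrow> 'a \<Rightarrow> 'x \<Rightarrow> bool) \<Rightarrow> 'a \<times> 'a \<Rightarrow> 'x \<times> 'x \<Rightarrow> bool"
  where "linked R p q \<longleftrightarrow> (\<exists>l. rel_prod (R l) (R l) p q)"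

text \<open>For the level sets of a map \<open>\<Phi>\<close> this is the lunar condition. Stated for
  relations, it covers the restrictions to subsets of the rows and columns. The last clause says that paths
  of length three are edges, so that the connected components of the graph are complete bipartite.\<close>

definition lunar_family :: "('l \<Rightarrow> 'a \<Rightarrow> 'x \<Rightarrow> bool) \<Rightarrow> bool"
  where "lunar_family R \<longleftrightarrow>
    (\<forall>l. partial_bij (R l)) \<and>
    (\<forall>l m a x. R l a x \<and> R m a x \<longrightarrow> l = m) \<and>
    (\<forall>p p' q q'. linked R p q \<and> linked R p' q \<and> linked R p q' \<longrightarrow> linked R p' q')"

definition op_sum :: "'l set \<Rightarrow> ('l \<Rightarrow> 'h ell2 \<Rightarrow> 'k ell2) \<Rightarrow> ('l \<Rightarrow> 'a \<Rightarrow> 'x \<Rightarrow> bool)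
    \<Rightarrow> ('h \<times> 'x) ell2 \<Rightarrow> ('k \<times> 'a) ell2"
  where "op_sum F T R \<xi> = (\<Sum>l\<in>F. amplify (T l) (R l) \<xi>)"

lemma bounded_linear_op_sum:
  assumes "\<And>l. l \<in> F \<Longrightarrow> bounded_clinear (T l)" "\<And>l. partial_bij (R l)"
  shows "bounded_linear (op_sum F T R)"
  unfolding op_sum_def
  by (intro bounded_linear_sum bounded_clinear_bounded_linear bounded_clinear_amplify assms)

lemma slice_op_sum:
  assumes "\<And>l. l \<in> F \<Longrightarrow> bounded_clinear (T l)" "\<And>l. partial_bij (R l)"
  shows "slice (op_sum F T R \<xi>) a = (\<Sum>l\<in>F. \<Sum>x | R l a x. T l (slice \<xi> x))"
  unfolding op_sum_def slice_sum using assms by (intro sum.cong refl slice_amplify)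

lemma slice_op_sum_reindex:
  assumes "\<And>l. l \<in> F \<Longrightarrow> bounded_clinear (T l)" "\<And>l. partial_bij (R l)" "partial_bij S"
  shows "slice (op_sum F T R (reindex S \<xi>)) a = (\<Sum>l\<in>F. \<Sum>x | (R l OO S) a x. T l (slice \<xi> x))"
  unfolding op_sum_def slice_sum reindex_def
  using assms by (intro sum.cong refl) (simp add: slice_amplify_amplify bounded_clinear_id)

context
  fixes R :: "'l \<Rightarrow> 'a \<Rightarrow> 'x \<Rightarrow> bool" and F :: "'l set" and T :: "'l \<Rightarrow> 'h ell2 \<Rightarrow> 'k ell2"
  assumes R: "lunar_family R" and T: "\<And>l. l \<in> F \<Longrightarrow> bounded_clinear (T l)"
begin

private lemma pb: "partial_bij (R l)"
  using R by (simp add: lunar_family_def)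

private lemma label_unique: "R l a x \<Longrightarrow> R m a x \<Longrightarrow> l = m"
  using R unfolding lunar_family_def by blast

private lemma linked_complete:
  assumes "linked R p q" "linked R p' q" "linked R p q'"
  shows "linked R p' q'"
proof -
  have "\<forall>p p' q q'. linked R p q \<and> linked R p' q \<and> linked R p q' \<longrightarrow> linked R p' q'"
    using R unfolding lunar_family_def by (elim conjE)
  with assms show ?thesis
    by blast
qed

private lemma pb2: "partial_bij (rel_prod (R l) (R l))"
  by (intro partial_bij_rel_prod pb)

private abbreviation (input) W where "W \<equiv> op_sum F T R"
private abbreviation (input) Z where "Z \<equiv> op_sum F T (\<lambda>l. rel_prod (R l) (R l))"

text \<open>A vector is spread out along the diagonal of \<open>X \<times> X\<close>. The diagonal rows of the larger operator then reproduce
  the smaller one, because \<open>(a, a)\<close> and \<open>(x, x)\<close> are related exactly when \<open>a\<close> and \<open>x\<close> are.\<close>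

lemma onorm_op_sum_le_square: "onorm (op_sum F T R) \<le> onorm (op_sum F T (\<lambda>l. rel_prod (R l) (R l)))"
proof (rule onorm_bound)
  have Z: "bounded_linear Z"
    by (intro bounded_linear_op_sum T pb2)
  show pos: "0 \<le> onorm Z"
    by (rule onorm_pos_le[OF Z])
  fix \<xi> :: "('h \<times> 'x) ell2"
  define diag where "diag = (\<lambda>(p :: 'x \<times> 'x) x. p = (x, x))"
  have diag: "partial_bij diag"
    by (auto simp: partial_bij_def diag_def)
  have diag_slice: "slice (Z (reindex diag \<xi>)) (a, a) = slice (W \<xi>) a" for a
  proof -
    have "(rel_prod (R l) (R l) OO diag) (a, a) = R l a" for l
      by (auto simp: diag_def rel_prod_sel relcompp_apply fun_eq_iff)
    then show ?thesis
      by (simp add: slice_op_sum_reindex[OF T pb2 diag] slice_op_sum[OF T pb])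
  qed
  have "(norm (W \<xi>))\<^sup>2 = (\<Sum>\<^sub>\<infinity>a. (norm (slice (Z (reindex diag \<xi>)) (a, a)))\<^sup>2)"
    by (simp add: norm_sq_slices diag_slice)
  also have "\<dots> = (\<Sum>\<^sub>\<infinity>p\<in>range (\<lambda>a. (a, a)). (norm (slice (Z (reindex diag \<xi>)) p))\<^sup>2)"
    by (subst infsum_reindex) (auto simp: inj_on_def o_def)
  also have "\<dots> \<le> (norm (Z (reindex diag \<xi>)))\<^sup>2"
    unfolding norm_sq_slices
    by (intro infsum_mono2 slices_summable summable_on_subset_banach[OF slices_summable]) auto
  finally have "norm (W \<xi>) \<le> norm (Z (reindex diag \<xi>))"
    by (rule power2_le_imp_le) simp
  also have "\<dots> \<le> onorm Z * norm (reindex diag \<xi>)"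
    by (rule onorm[OF Z])
  also have "norm (reindex diag \<xi>) = norm \<xi>"
  proof -
    have "{x. \<exists>p. diag p x} = UNIV"
      by (auto simp: diag_def)
    then have "(norm (reindex diag \<xi>))\<^sup>2 = (norm \<xi>)\<^sup>2"
      by (simp add: norm_reindex[OF diag] norm_sq_slices[of \<xi>])
    then show ?thesis
      by simp
  qed
  finally show "norm (W \<xi>) \<le> onorm Z * norm \<xi>" .
qed

text \<open>The component of \<open>p\<close>, recorded by its \<open>X \<times> X\<close> side. Completeness makes the neighbours of one
  vertex the whole side, so components need no transitive closure, and the empty set stands for an isolated
  vertex.\<close>

private definition block where "block p = {q. linked R p q}"

private lemma block_disjoint:
  assumes "block p \<noteq> block p'"
  shows "block p \<inter> block p' = {}"
proof (rule ccontr)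
  assume "block p \<inter> block p' \<noteq> {}"
  then obtain q where "linked R p q" "linked R p' q"
    by (auto simp: block_def)
  then have "linked R p q' \<longleftrightarrow> linked R p' q'" for q'
    using linked_complete by blast
  then show False
    using assms by (simp add: block_def)
qed

private lemma linked_left:
  assumes "linked R p q" "linked R p' q" "fst p = fst p'"
  shows "p = p'"
proof -
  obtain l m where l: "rel_prod (R l) (R l) p q" and m: "rel_prod (R m) (R m) p' q"
    using assms by (auto simp: linked_def)
  then have "l = m"
    using assms(3) by (auto simp: rel_prod_sel intro: label_unique)
  with l m show ?thesis
    using partial_bij_right[OF pb2] by blast
qed

private lemma linked_right:
  assumes "linked R p q" "linked R p q'" "fst q = fst q'"
  shows "q = q'"
proof -
  obtain l m where l: "rel_prod (R l) (R l) p q" and m: "rel_prod (R m) (R m) p q'"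
    using assms by (auto simp: linked_def)
  then have "l = m"
    using assms(3) by (auto simp: rel_prod_sel intro: label_unique)
  with l m show ?thesis
    using partial_bij_left[OF pb2] by blast
qed

text \<open>Over a single component the larger operator is a submatrix of the smaller one: the slices of \<open>\<eta>\<close> on \<open>c\<close> are
  moved to their first coordinates, which are pairwise different, the smaller operator is applied, and the rows with the
  first coordinates of the points of \<open>P\<close> are read off.\<close>

private lemma block_bound:
  assumes "finite P" "\<And>p. p \<in> P \<Longrightarrow> block p = c"
  shows "(\<Sum>p\<in>P. (norm (slice (Z \<eta>) p))\<^sup>2) \<le> (onorm W)\<^sup>2 * (\<Sum>\<^sub>\<infinity>q\<in>c. (norm (slice \<eta> q))\<^sup>2)"
proof (cases "P = {} \<or> c = {}")
  case True
  have "slice (Z \<eta>) p = 0" if "p \<in> P" for p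
  proof -
    have "\<not> rel_prod (R l) (R l) p q" for l q
      using True that assms(2)[OF that] by (auto simp: block_def linked_def)
    then show ?thesis
      by (simp add: slice_op_sum[OF T pb2])
  qed
  then show ?thesis
    by (simp add: infsum_nonneg)
next
  case False
  then obtain p\<^sub>0 q\<^sub>0 where p\<^sub>0: "p\<^sub>0 \<in> P" and q\<^sub>0: "q\<^sub>0 \<in> c"
    by blast
  have W: "bounded_linear W"
    by (intro bounded_linear_op_sum T pb)
  define J where "J = (\<lambda>x q. q \<in> c \<and> fst q = x)"
  have J: "partial_bij J"
    unfolding partial_bij_def J_def assms(2)[OF p\<^sub>0, symmetric] block_def
    using linked_right by blast
  \<comment> \<open>If \<open>q\<close> lies in the component of \<open>p\<close>, then \<open>p\<close> and \<open>q\<close> are linked through some label; the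
    first coordinates already determine it, so a relation of first coordinates entails one of the
    second coordinates with the same label.\<close>
  have slice_block: "slice (W (reindex J \<eta>)) (fst p) = slice (Z \<eta>) p" if p: "p \<in> P" for p
  proof -
    have "(R l OO J) (fst p) q \<longleftrightarrow> rel_prod (R l) (R l) p q" for l q
    proof
      assume "(R l OO J) (fst p) q"
      then have l: "R l (fst p) (fst q)" and "linked R p q"
        using assms(2)[OF p] by (auto simp: J_def block_def)
      then obtain m where m: "rel_prod (R m) (R m) p q"
        by (auto simp: linked_def)
      then have "m = l"
        using l label_unique unfolding rel_prod_sel by blast
      with m show "rel_prod (R l) (R l) p q"
        by simp
    next
      assume l: "rel_prod (R l) (R l) p q"
      then have "q \<in> c"
        using assms(2)[OF p] by (auto simp: block_def linked_def)
      with l show "(R l OO J) (fst p) q"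
        by (auto simp: J_def rel_prod_sel)
    qed
    then show ?thesis
      by (simp add: slice_op_sum_reindex[OF T pb J] slice_op_sum[OF T pb2])
  qed
  have "inj_on fst P"
  proof (rule inj_onI)
    fix p p'
    assume "p \<in> P" "p' \<in> P" "fst p = fst p'"
    moreover from this have "linked R p q\<^sub>0" "linked R p' q\<^sub>0"
      using assms(2) q\<^sub>0 unfolding block_def by blast+
    ultimately show "p = p'"
      using linked_left by blast
  qed
  then have "(\<Sum>p\<in>P. (norm (slice (Z \<eta>) p))\<^sup>2) = (\<Sum>a\<in>fst ` P. (norm (slice (W (reindex J \<eta>)) a))\<^sup>2)"
    by (simp add: sum.reindex slice_block)
  also have "\<dots> \<le> (norm (W (reindex J \<eta>)))\<^sup>2"
    unfolding norm_sq_slices using assms(1) by (intro finite_sum_le_infsum slices_summable) auto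
  also have "\<dots> \<le> (onorm W * norm (reindex J \<eta>))\<^sup>2"
    by (intro power_mono onorm[OF W]) simp
  also have "\<dots> = (onorm W)\<^sup>2 * (\<Sum>\<^sub>\<infinity>q\<in>c. (norm (slice \<eta> q))\<^sup>2)"
    by (simp add: power_mult_distrib norm_reindex[OF J]) (simp add: J_def)
  finally show ?thesis .
qed

text \<open>The components partition the rows and their column sets are disjoint, so the estimates over the single
  components add up.\<close>

lemma onorm_square_le_op_sum: "onorm (op_sum F T (\<lambda>l. rel_prod (R l) (R l))) \<le> onorm (op_sum F T R)"
proof (rule onorm_bound)
  have W: "bounded_linear W"
    by (intro bounded_linear_op_sum T pb)
  show pos: "0 \<le> onorm W"
    by (rule onorm_pos_le[OF W])
  fix \<eta> :: "('h \<times> ('x \<times> 'x)) ell2"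
  let ?g = "\<lambda>q. (norm (slice \<eta> q))\<^sup>2"
  have "(norm (Z \<eta>))\<^sup>2 \<le> (onorm W)\<^sup>2 * (norm \<eta>)\<^sup>2"
    unfolding norm_sq_slices[of "Z \<eta>"]
  \<comment> \<open>Finitely many rows meet only finitely many components.\<close>
  proof (rule infsum_le_finite_sums[OF slices_summable])
    fix P :: "('a \<times> 'a) set"
    assume P: "finite P"
    have disj: "c \<inter> c' = {}" if "c \<in> block ` P" "c' \<in> block ` P" "c \<noteq> c'" for c c'
      using that block_disjoint by blast
    have "(\<Sum>p\<in>P. (norm (slice (Z \<eta>) p))\<^sup>2)
      = (\<Sum>c\<in>block ` P. \<Sum>p\<in>{p \<in> P. block p = c}. (norm (slice (Z \<eta>) p))\<^sup>2)"
      by (rule sum.image_gen[OF P])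
    also have "\<dots> \<le> (\<Sum>c\<in>block ` P. (onorm W)\<^sup>2 * infsum ?g c)"
      using P by (intro sum_mono block_bound) auto
    also have "\<dots> = (onorm W)\<^sup>2 * (\<Sum>c\<in>block ` P. infsum ?g c)"
      by (simp add: sum_distrib_left)
    also have "(\<Sum>c\<in>block ` P. infsum ?g c) = infsum ?g (\<Union>c\<in>block ` P. c)"
      using P disj by (intro sum_infsum summable_on_subset_banach[OF slices_summable]) simp_all
    also have "\<dots> \<le> (norm \<eta>)\<^sup>2"
      unfolding norm_sq_slices
      by (intro infsum_mono2 slices_summable summable_on_subset_banach[OF slices_summable]) auto
    finally show "(\<Sum>p\<in>P. (norm (slice (Z \<eta>) p))\<^sup>2) \<le> (onorm W)\<^sup>2 * (norm \<eta>)\<^sup>2"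
      by (simp add: mult_left_mono)
  qed
  then have "(norm (Z \<eta>))\<^sup>2 \<le> (onorm W * norm \<eta>)\<^sup>2"
    by (simp add: power_mult_distrib)
  then show "norm (Z \<eta>) \<le> onorm W * norm \<eta>"
    by (rule power2_le_imp_le) (simp add: pos)
qed

end

text \<open>The two operators have the same norm in every single representation, hence so have their suprema.\<close>

theorem has_sap_lunar_family:
  fixes R :: "'l \<Rightarrow> 'a \<Rightarrow> 'x \<Rightarrow> bool"
  assumes "lunar_family R"
  shows "has_sap TYPE('b::cstar_algebra) (\<lambda>l. pbij_op (R l))"
  unfolding has_sap_def
proof (intro conjI allI impI)
  have R: "partial_bij (R l)" for l
    using assms by (simp add: lunar_family_def)
  show "bounded_clinear (pbij_op (R l))" for l
    by (intro bounded_clinear_pbij_op R)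
  fix b :: "'l \<Rightarrow> 'b"
  show "min_norm b (\<lambda>l. pbij_op (R l))
    = min_norm b (\<lambda>l. tensor_op (pbij_op (R l)) (conj_op (pbij_op (R l))))"
    unfolding min_norm_def
  proof (rule SUP_cong[OF refl])
    fix \<pi> :: "'b \<Rightarrow> 'b ell2 \<Rightarrow> 'b ell2"
    assume "\<pi> \<in> {\<pi>. star_representation \<pi>}"
    then have \<pi>: "bounded_clinear (\<pi> c)" for c
      by (simp add: star_representation_def)
    let ?W = "op_sum {l. b l \<noteq> 0} (\<lambda>l. \<pi> (b l))"
    have "onorm (?W R) = onorm (?W (\<lambda>l. rel_prod (R l) (R l)))"
      using onorm_op_sum_le_square[OF assms \<pi>] onorm_square_le_op_sum[OF assms \<pi>]
      by (rule antisym)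
    then show "onorm (\<lambda>\<xi>. \<Sum>l | b l \<noteq> 0. tensor_op (\<pi> (b l)) (pbij_op (R l)) \<xi>)
      = onorm (\<lambda>\<xi>. \<Sum>l | b l \<noteq> 0.
          tensor_op (\<pi> (b l)) (tensor_op (pbij_op (R l)) (conj_op (pbij_op (R l)))) \<xi>)"
      by (simp add: op_sum_def[abs_def] conj_op_pbij_op[OF R] tensor_op_pbij_op_pbij_op[OF R R]
          tensor_op_pbij_op[OF \<pi> R] tensor_op_pbij_op[OF \<pi> partial_bij_rel_prod[OF R R]])
  qed
qed

section \<open>Hankel systems\<close>

lemma hankel_eq_pbij_op:
  assumes "lunar \<Phi>"
  shows "partial_bij (\<lambda>a x. \<Phi> a x = l)" "hankel \<Phi> l = pbij_op (\<lambda>a x. \<Phi> a x = l)"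
proof -
  have "inj (\<Phi> a)" "inj (\<lambda>a. \<Phi> a x)" for a x
    using assms unfolding lunar_def by blast+
  then show R: "partial_bij (\<lambda>a x. \<Phi> a x = l)"
    unfolding partial_bij_def inj_def by metis
  show "hankel \<Phi> l = pbij_op (\<lambda>a x. \<Phi> a x = l)"
    unfolding hankel_def by (rule op_of_matrix_partial_bij[OF R])
qed

lemma lunar_family_compression:
  assumes "lunar \<Phi>"
  shows "lunar_family (\<lambda>l a x. a \<in> S\<^sub>1 \<and> x \<in> S\<^sub>2 \<and> \<Phi> a x = l)"
proof -
  let ?R = "\<lambda>l a x. a \<in> S\<^sub>1 \<and> x \<in> S\<^sub>2 \<and> \<Phi> a x = l"
  have "partial_bij (?R l)" for l
    using hankel_eq_pbij_op(1)[OF assms, of l] unfolding partial_bij_def by blast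
  moreover have "linked ?R p' q'" if "linked ?R p q" "linked ?R p' q" "linked ?R p q'" for p p' q q'
  proof -
    have "\<Phi> (fst p) (fst q) = \<Phi> (snd p) (snd q)" "\<Phi> (fst p') (fst q) = \<Phi> (snd p') (snd q)"
      "\<Phi> (fst p) (fst q') = \<Phi> (snd p) (snd q')"
      using that by (auto simp: linked_def rel_prod_sel)
    then have "\<Phi> (fst p') (fst q') = \<Phi> (snd p') (snd q')"
      using assms unfolding lunar_def by blast
    then show ?thesis
      using that by (auto simp: linked_def rel_prod_sel)
  qed
  ultimately show ?thesis
    unfolding lunar_family_def by blast
qed

theorem corollary5p1:
  fixes \<Phi> :: "'a \<Rightarrow> 'x \<Rightarrow> 'l"
  assumes "lunar \<Phi>"
  shows "has_hereditary_sap TYPE('b::cstar_algebra) (hankel \<Phi>)"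
  unfolding has_hereditary_sap_def hankel_eq_pbij_op(2)[OF assms]
    proj_pbij_op[OF hankel_eq_pbij_op(1)[OF assms]]
  by (intro allI has_sap_lunar_family lunar_family_compression assms)

end
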